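(* Let $X(t)=\{x_j(t)\}_{j=1}^J$ be the position component of a solution of the linear second-order EKI system $$\ddot x_j+\gamma\dot x_j=-\beta C(X)(Ax_j-b)+k\sum_{i\neq j}f(\|x_i-x_j\|)(x_j-x_i)-\alpha(x_j-\bar x),\qquad j=1,\dots,J.$$ Then the ensemble mean $\bar x(t)=\frac1J\sum_{j}x_j(t)$ satisfies $$\ddot{\bar x}(t)+\gamma\dot{\bar x}(t)=-\beta C(X(t))(A\bar x(t)-b),$$ whereas the fluctuations $\tilde x_j(t):=x_j(t)-\bar x(t)$ satisfy, for $j=1,\dots,J$, $$\ddot{\tilde x}_j(t)+\gamma\dot{\tilde x}_j(t)=-\beta C(X(t))A\tilde x_j(t)-\alpha\tilde x_j(t)+k\sum_{i\neq j}f(\|\tilde x_i(t)-\tilde x_j(t)\|)\bigl(\tilde x_j(t)-\tilde x_i(t)\bigr).$$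
   Context: Here $x_j(t)\in\mathbb R^d$, $j=1,\dots,J$; $G\in\mathbb R^{K\times d}$ is a matrix (linear forward map), $\Gamma\in\mathbb R^{K\times K}$ is symmetric positive definite, $y\in\mathbb R^K$, $A:=G^T\Gamma^{-1}G$, $b:=G^T\Gamma^{-1}y$. The empirical covariance is $C(X)=\frac1J\sum_{j=1}^J(x_j-\bar x)(x_j-\bar x)^T\in\mathbb R^{d\times d}$. Parameters: $\gamma>0$, $\beta>0$, $k\ge0$, $\alpha\ge0$. The interaction kernel $f:[0,\infty)\to(0,\infty)$ is smooth and non-increasing. $\|\cdot\|$ is the Euclidean norm. *)

theory Defs
  imports "HOL-Analysis.Analysis"
begin

definition sym_pos_def :: "real ^ 'n ^ 'n \<Rightarrow> bool" where
  "sym_pos_def M \<longleftrightarrow> transpose M = M \<and> (\<forall>v. v \<noteq> 0 \<longrightarrow> 0 < v \<bullet> (M *v v))"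

(* Smoothness on the closed half-line: derivatives of all orders exist on [0, \<infinity>), one-sided at 0;
   values of f at negative arguments are irrelevant. *)
definition smooth_halfline :: "(real \<Rightarrow> real) \<Rightarrow> bool" where
  "smooth_halfline f \<longleftrightarrow>
     (\<exists>D :: nat \<Rightarrow> real \<Rightarrow> real. D 0 = f \<and>
        (\<forall>n. \<forall>r\<ge>0. (D n has_real_derivative D (Suc n) r) (at r within {0..})))"

definition interaction_kernel :: "(real \<Rightarrow> real) \<Rightarrow> bool" where
  "interaction_kernel f \<longleftrightarrow>
     (\<forall>r\<ge>0. 0 < f r) \<and> smooth_halfline f \<and> antimono_on {0..} f"

definition ens_mean :: "('j::finite \<Rightarrow> real ^ 'd) \<Rightarrow> real ^ 'd" where
  "ens_mean x = (1 / real CARD('j)) *\<^sub>R (\<Sum>j\<in>UNIV. x j)"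

definition outer :: "real ^ 'd \<Rightarrow> real ^ 'd \<Rightarrow> real ^ 'd ^ 'd" where
  "outer u v = (columnvector u :: real ^ 1 ^ 'd) ** (rowvector v :: real ^ 'd ^ 1)"

definition ens_cov :: "('j::finite \<Rightarrow> real ^ 'd) \<Rightarrow> real ^ 'd ^ 'd" where
  "ens_cov x = (1 / real CARD('j)) *\<^sub>R
     (\<Sum>j\<in>UNIV. outer (x j - ens_mean x) (x j - ens_mean x))"

definition fwd_A :: "real ^ 'd ^ 'k \<Rightarrow> real ^ 'k ^ 'k \<Rightarrow> real ^ 'd ^ 'd" where
  "fwd_A G \<Gamma> = transpose G ** matrix_inv \<Gamma> ** G"

definition fwd_b :: "real ^ 'd ^ 'k \<Rightarrow> real ^ 'k ^ 'k \<Rightarrow> real ^ 'k \<Rightarrow> real ^ 'd" where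
  "fwd_b G \<Gamma> y = (transpose G ** matrix_inv \<Gamma>) *v y"

(* u is twice differentiable on I and u'' + \<gamma> u' = F there. Derivatives are taken within I,
   hence one-sided at endpoints belonging to I; on an interval with nonempty interior they are
   unique, so v and a are u' and u''. *)
definition solves_damped ::
  "real set \<Rightarrow> real \<Rightarrow> (real \<Rightarrow> 'a::real_normed_vector) \<Rightarrow> (real \<Rightarrow> 'a) \<Rightarrow> bool" where
  "solves_damped I \<gamma> u F \<longleftrightarrow>
     (\<exists>v a. \<forall>t\<in>I. (u has_vector_derivative v t) (at t within I) \<and>
                  (v has_vector_derivative a t) (at t within I) \<and>
                  a t + \<gamma> *\<^sub>R v t = F t)"

definition eki_solution ::
  "real set \<Rightarrow> real \<Rightarrow> real \<Rightarrow> real \<Rightarrow> real \<Rightarrow> (real \<Rightarrow> real) \<Rightarrow> real ^ 'd ^ 'd \<Rightarrow> real ^ 'd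
     \<Rightarrow> (real \<Rightarrow> 'j::finite \<Rightarrow> real ^ 'd) \<Rightarrow> bool" where
  "eki_solution I \<gamma> \<beta> k \<alpha> f A b X \<longleftrightarrow>
     (\<forall>j. solves_damped I \<gamma> (\<lambda>t. X t j)
        (\<lambda>t. - (\<beta> *\<^sub>R (ens_cov (X t) *v (A *v X t j - b)))
             + k *\<^sub>R (\<Sum>i\<in>UNIV - {j}. f (norm (X t i - X t j)) *\<^sub>R (X t j - X t i))
             - \<alpha> *\<^sub>R (X t j - ens_mean (X t))))"

definition fluct :: "('j::finite \<Rightarrow> real ^ 'd) \<Rightarrow> 'j \<Rightarrow> real ^ 'd" where
  "fluct x j = x j - ens_mean x"

end

theory Submission
  imports Defs
begin

(* The mean equation is the average of the particle equations: averaging commutes with the linear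
   part, the pairwise forces cancel by antisymmetry, and the confinement term averages to zero.
   The fluctuation equations are then the differences between the particle equations and the mean
   equation, in which b drops out, while differences of particles are differences of fluctuations. *)

lemma solves_dampedI:
  assumes "\<And>t. t \<in> I \<Longrightarrow> (u has_vector_derivative v t) (at t within I)"
    and "\<And>t. t \<in> I \<Longrightarrow> (v has_vector_derivative a t) (at t within I)"
    and "\<And>t. t \<in> I \<Longrightarrow> a t + \<gamma> *\<^sub>R v t = F t"
  shows "solves_damped I \<gamma> u F"
  unfolding solves_damped_def by (rule exI[of _ v], rule exI[of _ a]) (simp add: assms)

text \<open>The operator u'' + \<gamma> u' is linear in u, so forces subtract along with solutions.
  This later turns the particle and mean equations into the fluctuation equations.\<close>

lemma solves_damped_diff:
  assumes "solves_damped I \<gamma> u F" and "solves_damped I \<gamma> w H"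
  shows "solves_damped I \<gamma> (\<lambda>t. u t - w t) (\<lambda>t. F t - H t)"
proof -
  obtain v a where 1: "\<And>t. t \<in> I \<Longrightarrow> (u has_vector_derivative v t) (at t within I) \<and>
      (v has_vector_derivative a t) (at t within I) \<and> a t + \<gamma> *\<^sub>R v t = F t"
    using assms(1) unfolding solves_damped_def by blast
  obtain v' a' where 2: "\<And>t. t \<in> I \<Longrightarrow> (w has_vector_derivative v' t) (at t within I) \<and>
      (v' has_vector_derivative a' t) (at t within I) \<and> a' t + \<gamma> *\<^sub>R v' t = H t"
    using assms(2) unfolding solves_damped_def by blast
  show ?thesis
  proof (rule solves_dampedI[where v = "\<lambda>t. v t - v' t" and a = "\<lambda>t. a t - a' t"])
    fix t assume t: "t \<in> I"
    show "((\<lambda>t. u t - w t) has_vector_derivative v t - v' t) (at t within I)"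
      using 1[OF t] 2[OF t] by (simp add: has_vector_derivative_diff)
    show "((\<lambda>t. v t - v' t) has_vector_derivative a t - a' t) (at t within I)"
      using 1[OF t] 2[OF t] by (simp add: has_vector_derivative_diff)
    have "F t = a t + \<gamma> *\<^sub>R v t" and "H t = a' t + \<gamma> *\<^sub>R v' t"
      using 1[OF t] 2[OF t] by simp_all
    then show "(a t - a' t) + \<gamma> *\<^sub>R (v t - v' t) = F t - H t"
      by (simp add: scaleR_diff_right)
  qed
qed

text \<open>The mean is a fixed finite linear combination of the particles, so it passes through
  both derivatives and the damping. The forces stay arbitrary here; their mean is computed
  separately.\<close>

lemma solves_damped_ens_mean:
  fixes X :: "real \<Rightarrow> 'j::finite \<Rightarrow> real ^ 'd"
  assumes "\<And>j. solves_damped I \<gamma> (\<lambda>t. X t j) (F j)"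
  shows "solves_damped I \<gamma> (\<lambda>t. ens_mean (X t)) (\<lambda>t. ens_mean (\<lambda>j. F j t))"
proof -
  have "\<exists>v a. \<forall>t\<in>I. ((\<lambda>t. X t j) has_vector_derivative v t) (at t within I) \<and>
      (v has_vector_derivative a t) (at t within I) \<and> a t + \<gamma> *\<^sub>R v t = F j t" for j
    using assms[of j] unfolding solves_damped_def .
  \<comment> \<open>Each particle brings its own velocity and acceleration; choosing them
    simultaneously for all \<open>j\<close> gives families that can be averaged.\<close>
  then obtain v a where va: "\<And>j t. t \<in> I \<Longrightarrow>
      ((\<lambda>t. X t j) has_vector_derivative v j t) (at t within I) \<and>
      (v j has_vector_derivative a j t) (at t within I) \<and> a j t + \<gamma> *\<^sub>R v j t = F j t"
    by metis
  have mean_deriv: "((\<lambda>t. ens_mean (\<lambda>j. g j t)) has_vector_derivative ens_mean (\<lambda>j. g' j t))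
      (at t within I)"
    if "\<And>j. (g j has_vector_derivative g' j t) (at t within I)"
    for g g' :: "'j \<Rightarrow> real \<Rightarrow> real ^ 'd" and t
    unfolding ens_mean_def
    by (intro bounded_linear.has_vector_derivative[OF bounded_linear_scaleR_right]
        has_vector_derivative_sum that)
  show ?thesis
  proof (rule solves_dampedI[where v = "\<lambda>t. ens_mean (\<lambda>j. v j t)"
        and a = "\<lambda>t. ens_mean (\<lambda>j. a j t)"])
    fix t assume t: "t \<in> I"
    show "((\<lambda>t. ens_mean (X t)) has_vector_derivative ens_mean (\<lambda>j. v j t)) (at t within I)"
      using mean_deriv[of "\<lambda>j t. X t j" v t] va[OF t] by simp
    show "((\<lambda>t. ens_mean (\<lambda>j. v j t)) has_vector_derivative ens_mean (\<lambda>j. a j t)) (at t within I)"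
      using mean_deriv[of v a t] va[OF t] by simp
    have "F j t = a j t + \<gamma> *\<^sub>R v j t" for j
      using va[OF t, of j] by simp
    then show "ens_mean (\<lambda>j. a j t) + \<gamma> *\<^sub>R ens_mean (\<lambda>j. v j t) = ens_mean (\<lambda>j. F j t)"
      by (simp add: ens_mean_def sum.distrib scaleR_add_right scaleR_left_commute
          flip: scaleR_sum_right)
  qed
qed

lemma ens_mean_add: "ens_mean (\<lambda>j. u j + v j) = ens_mean u + ens_mean v"
  by (simp add: ens_mean_def sum.distrib scaleR_add_right)

lemma ens_mean_diff: "ens_mean (\<lambda>j. u j - v j) = ens_mean u - ens_mean v"
  by (simp add: ens_mean_def sum_subtractf scaleR_diff_right)

lemma ens_mean_const: "ens_mean (\<lambda>j::'j::finite. c) = c"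
  by (simp add: ens_mean_def sum_constant_scaleR del: sum_constant)

lemma ens_mean_linear:
  assumes "linear h"
  shows "ens_mean (\<lambda>j. h (u j)) = h (ens_mean u)"
  by (simp add: ens_mean_def linear_sum[OF assms] linear_scale[OF assms])

text \<open>Exchanging the two summations turns the sum into its own negative. The exchange needs a
  full square of indices, and the excluded diagonal can be restored because antisymmetry at i = j
  makes it vanish.\<close>

lemma sum_antisymmetric_eq_0:
  fixes g :: "'a \<Rightarrow> 'a \<Rightarrow> 'b::real_vector"
  assumes "finite S" and antisym: "\<And>i j. g i j = - g j i"
  shows "(\<Sum>j\<in>S. \<Sum>i\<in>S - {j}. g j i) = 0"
proof -
  \<comment> \<open>Here 2x = 0, and 2 is invertible as a real scalar. This serves both the diagonal
    entries and the whole sum.\<close>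
  have self_neg: "x = 0" if "x = - x" for x :: 'b
    using that[unfolded eq_neg_iff_add_eq_0 scaleR_2[symmetric]] by simp
  have diag: "g j j = 0" for j
    by (rule self_neg[OF antisym])
  have "(\<Sum>i\<in>S - {j}. g j i) = (\<Sum>i\<in>S. g j i)" for j
    using assms(1) diag by (intro sum.mono_neutral_left) auto
  then have off_diag: "(\<Sum>j\<in>S. \<Sum>i\<in>S - {j}. g j i) = (\<Sum>j\<in>S. \<Sum>i\<in>S. g j i)"
    by simp
  have "(\<Sum>j\<in>S. \<Sum>i\<in>S. g j i) = (\<Sum>i\<in>S. \<Sum>j\<in>S. - g i j)"
    by (subst sum.swap) (intro sum.cong refl antisym)
  also have "\<dots> = - (\<Sum>j\<in>S. \<Sum>i\<in>S. g j i)"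
    by (simp only: sum_negf)
  finally show ?thesis
    unfolding off_diag by (rule self_neg)
qed

text \<open>The weight depends only on the distance and is thus symmetric in the pair, while the
  displacement changes sign: action equals reaction for any \<open>f\<close>.\<close>

lemma ens_mean_interaction:
  fixes x :: "'j::finite \<Rightarrow> real ^ 'd"
  shows "ens_mean (\<lambda>j. \<Sum>i\<in>UNIV - {j}. f (norm (x i - x j)) *\<^sub>R (x j - x i)) = 0"
proof -
  have "f (norm (x i - x j)) *\<^sub>R (x j - x i) = - (f (norm (x j - x i)) *\<^sub>R (x i - x j))" for i j
    unfolding norm_minus_commute[of "x j" "x i"] scaleR_minus_right[symmetric] minus_diff_eq ..
  then have "(\<Sum>j\<in>UNIV. \<Sum>i\<in>UNIV - {j}. f (norm (x i - x j)) *\<^sub>R (x j - x i)) = 0"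
    by (intro sum_antisymmetric_eq_0 finite)
  then show ?thesis
    by (simp add: ens_mean_def)
qed

theorem lemma3p1:
  fixes G :: "real ^ 'd ^ 'k" and \<Gamma> :: "real ^ 'k ^ 'k" and y :: "real ^ 'k"
    and A :: "real ^ 'd ^ 'd" and b :: "real ^ 'd"
    and f :: "real \<Rightarrow> real" and \<gamma> \<beta> k \<alpha> :: real
    and I :: "real set" and X :: "real \<Rightarrow> 'j::finite \<Rightarrow> real ^ 'd"
  assumes "sym_pos_def \<Gamma>"
    and "A = fwd_A G \<Gamma>" and "b = fwd_b G \<Gamma> y"
    and "\<gamma> > 0" and "\<beta> > 0" and "k \<ge> 0" and "\<alpha> \<ge> 0"
    and "interaction_kernel f"
    and "is_interval I" and "interior I \<noteq> {}"
    and "eki_solution I \<gamma> \<beta> k \<alpha> f A b X"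
  shows "solves_damped I \<gamma> (\<lambda>t. ens_mean (X t))
           (\<lambda>t. - (\<beta> *\<^sub>R (ens_cov (X t) *v (A *v ens_mean (X t) - b))))
    \<and> (\<forall>j. solves_damped I \<gamma> (\<lambda>t. fluct (X t) j)
           (\<lambda>t. - (\<beta> *\<^sub>R (ens_cov (X t) *v (A *v fluct (X t) j)))
                - \<alpha> *\<^sub>R fluct (X t) j
                + k *\<^sub>R (\<Sum>i\<in>UNIV - {j}. f (norm (fluct (X t) i - fluct (X t) j))
                                        *\<^sub>R (fluct (X t) j - fluct (X t) i))))"
proof -
  define F where "F j t = - (\<beta> *\<^sub>R (ens_cov (X t) *v (A *v X t j - b)))
      + k *\<^sub>R (\<Sum>i\<in>UNIV - {j}. f (norm (X t i - X t j)) *\<^sub>R (X t j - X t i))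
      - \<alpha> *\<^sub>R (X t j - ens_mean (X t))" for j t
  define H where "H t = - (\<beta> *\<^sub>R (ens_cov (X t) *v (A *v ens_mean (X t) - b)))" for t
  have particle: "solves_damped I \<gamma> (\<lambda>t. X t j) (F j)" for j
    using assms(11) unfolding eki_solution_def F_def by blast
  have "ens_mean (\<lambda>j. F j t) = H t" for t
  proof -
    \<comment> \<open>The covariance depends on the whole ensemble but not on \<open>j\<close>. At
      fixed \<open>t\<close> it is therefore a constant matrix that can be pulled out of the mean,
      although the system is nonlinear in \<open>X\<close>.\<close>
    have lin: "linear (\<lambda>x. - (\<beta> *\<^sub>R (ens_cov (X t) *v x)))"
      by (intro linear_compose_neg linear_compose_scale_right matrix_vector_mul_linear)
    \<comment> \<open>Stated in the split form that \<open>ens_mean_diff\<close> produces; likewise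
      for the confinement term below.\<close>
    have "ens_mean (\<lambda>j. A *v X t j) - ens_mean (\<lambda>j::'j. b) = A *v ens_mean (X t) - b"
      by (simp add: ens_mean_const ens_mean_linear[OF matrix_vector_mul_linear])
    moreover have "ens_mean (X t) - ens_mean (\<lambda>j::'j. ens_mean (X t)) = 0"
      by (simp add: ens_mean_const)
    ultimately show ?thesis
      unfolding F_def H_def
      by (simp only: ens_mean_add ens_mean_diff ens_mean_linear[OF lin]
          ens_mean_linear[OF linear_scaleR] ens_mean_interaction scaleR_zero_right
          add_0_right diff_0_right)
  qed
  then have mean: "solves_damped I \<gamma> (\<lambda>t. ens_mean (X t)) H"
    using solves_damped_ens_mean[of I \<gamma> X F, OF particle] by simp
  \<comment> \<open>Both drift terms carry the same covariance, so only A applied to x_j minus the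
    mean survives. The other two forces come from \<open>F\<close> alone and already depend only on
    fluctuations.\<close>
  have fluct_rhs: "F j t - H t = - (\<beta> *\<^sub>R (ens_cov (X t) *v (A *v fluct (X t) j))) - \<alpha> *\<^sub>R fluct (X t) j
      + k *\<^sub>R (\<Sum>i\<in>UNIV - {j}. f (norm (fluct (X t) i - fluct (X t) j))
          *\<^sub>R (fluct (X t) j - fluct (X t) i))" for j t
    by (simp add: F_def H_def fluct_def matrix_vector_mult_diff_distrib scaleR_diff_right)
  have "solves_damped I \<gamma> (\<lambda>t. fluct (X t) j) (\<lambda>t. F j t - H t)" for j
    unfolding fluct_def by (rule solves_damped_diff[OF particle mean])
  then show ?thesis
    using mean unfolding fluct_rhs unfolding H_def by blast
qed

end
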